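(* Assume there is a constant $C>0$, independent of $t$, such that for all $\tau,\sigma>0$, $\|S_t(\tau)S_t(\sigma)-S_t(\tau+\sigma)\|_{L^2_B\to L^2_B}\le C\,s(t)/\sqrt\sigma$, where $S_t(\tau)=P_te^{-\tau H_t}I_t$. Then the following two statements are equivalent: (S) For every $\tau>0$, $S_t(\tau)\to e^{-\tau H_B}$ strongly on $L^2_B$ as $t\downarrow0$. (K) For every $\tau>0$ and every $\Phi,\Psi\in L^2(B_0)$, as $t\downarrow 0$, $$\int_{X_{t,0}\times X_{t,0}}K_t(x,y;\tau)(I_t\Phi)(x)(I_t\Psi)(y)\,d\mu_t(x)\,d\mu_t(y)\ \longrightarrow\ \int_{B_0\times B_0}K_B(b,b';\tau)\Phi(b)\Psi(b')\,d\mu_B(b)\,d\mu_B(b').$$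
   Context: Setting. $(B,g_B)$ is a smooth Riemannian surface, $D\subset B$ is finite, $B_{\mathrm{reg}}=B\setminus D$. For $t\in(0,t_0]$, $(X_t,g(t))$ is a Riemannian manifold with a smooth surjective submersion $\Pi_t:X_t\to B_{\mathrm{reg}}$ whose fibers $F_{b,t}=\Pi_t^{-1}(b)$ are flat $2$-tori. $B_0\Subset B_{\mathrm{reg}}$ is a precompact domain with smooth boundary, $X_{t,0}=\Pi_t^{-1}(B_0)$, $\mu_B=\mu_{g_B}$, $\mu_t=\mu_{g(t)}$, $L^2_B=L^2(B_0,\mu_B)$, $L^2_t=L^2(X_{t,0},\mu_t)$. $s(t)>0$ is the collapse scale, $s(t)\downarrow0$ as $t\downarrow0$. Normalized disintegration: with $d\vartheta_{b,t}$ the Haar probability measure on $F_{b,t}$, there are measurable $A_t:B_0\to(0,\infty)$, $\rho_t:X_{t,0}\to(0,\infty)$ with $\int_{X_{t,0}}f\,d\mu_t=\int_{B_0}A_t(b)\big(\int_{F_{b,t}}f\rho_t\,d\vartheta_{b,t}\big)d\mu_B(b)$ for all $f\in L^1(X_{t,0},\mu_t)$ and $\int_{F_{b,t}}\rho_t\,d\vartheta_{b,t}=1$ for all $b\in B_0$. Operators. $(I_tv)(x)=A_t(\Pi_tx)^{-1/2}v(\Pi_tx)$ for $v\in L^2_B$; $(P_tu)(b)=A_t(b)^{1/2}\int_{F_{b,t}}u\rho_t\,d\vartheta_{b,t}$ for $u\in L^2_t$. $H_B$ and $H_t$ are the nonnegative selfadjoint Dirichlet Laplacians on $L^2_B$ and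 $L^2_t$, associated with the forms $E_B[v]=\int_{B_0}|\nabla v|_{g_B}^2d\mu_B$ on $H_0^1(B_0)$ and $E_t[u]=\int_{X_{t,0}}|\nabla u|_{g(t)}^2d\mu_t$ on $H^1_0(X_{t,0})$. $K_B(\cdot,\cdot;\tau)$, $K_t(\cdot,\cdot;\tau)$ are the (symmetric, $L^2$) integral kernels of $e^{-\tau H_B}$ and $e^{-\tau H_t}$. *)

theory Defs
  imports "HOL-Probability.Probability_Measure"
begin

section \<open>Smooth and Riemannian manifolds\<close>

text \<open>The sets \<open>S\<close> below are always open, so \<open>at x\<close> is the two-sided filter inside \<open>S\<close>.\<close>

primrec Ck_on :: "nat \<Rightarrow> 'a::euclidean_space set \<Rightarrow> ('a \<Rightarrow> 'b::real_normed_vector) \<Rightarrow> bool" where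
  "Ck_on 0 S f = continuous_on S f"
| "Ck_on (Suc k) S f = ((\<forall>x\<in>S. f differentiable at x) \<and>
     (\<forall>v. Ck_on k S (\<lambda>x. frechet_derivative f (at x) v)))"

definition smooth_on :: "'a::euclidean_space set \<Rightarrow> ('a \<Rightarrow> 'b::real_normed_vector) \<Rightarrow> bool" where
  "smooth_on S f \<longleftrightarrow> (\<forall>k. Ck_on k S f)"

text \<open>A chart is a pair of its domain and its coordinate map (arbitrary outside the domain).\<close>

type_synonym ('a, 'n) chart = "'a set \<times> ('a \<Rightarrow> real ^ 'n)"

definition chart_image :: "('a, 'n) chart \<Rightarrow> 'a set \<Rightarrow> (real ^ 'n) set" where
  "chart_image c S = snd c ` (fst c \<inter> S)"

definition chart_inv :: "('a, 'n) chart \<Rightarrow> real ^ 'n \<Rightarrow> 'a" where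
  "chart_inv c = inv_into (fst c) (snd c)"

definition second_countable_space :: "'a topology \<Rightarrow> bool" where
  "second_countable_space X \<longleftrightarrow> (\<exists>\<B>. countable \<B> \<and> (\<forall>V\<in>\<B>. openin X V) \<and>
     (\<forall>U x. openin X U \<and> x \<in> U \<longrightarrow> (\<exists>V\<in>\<B>. x \<in> V \<and> V \<subseteq> U)))"

definition smooth_atlas :: "'a topology \<Rightarrow> ('a, 'n::finite) chart set \<Rightarrow> bool" where
  "smooth_atlas X \<A> \<longleftrightarrow>
     Hausdorff_space X \<and> second_countable_space X \<and> (\<Union>c\<in>\<A>. fst c) = topspace X \<and>
     (\<forall>c\<in>\<A>. openin X (fst c) \<and> open (snd c ` fst c) \<and>
        homeomorphic_map (subtopology X (fst c)) (top_of_set (snd c ` fst c)) (snd c)) \<and>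
     (\<forall>c\<in>\<A>. \<forall>d\<in>\<A>. smooth_on (chart_image c (fst d)) (snd d \<circ> chart_inv c))"

text \<open>
  A metric tensor is given by its components: \<open>gmetric M c p v w\<close> is \<open>g\<^sub>p\<close> applied to the tangent
  vectors at \<open>p\<close> whose coordinates in the chart \<open>c\<close> are \<open>v\<close> and \<open>w\<close>.
\<close>

record ('a, 'n) riem =
  mtop :: "'a topology"
  atlas :: "('a, 'n) chart set"
  gmetric :: "('a, 'n) chart \<Rightarrow> 'a \<Rightarrow> real ^ 'n \<Rightarrow> real ^ 'n \<Rightarrow> real"

definition transition_deriv ::
    "('a, 'n::finite) chart \<Rightarrow> ('a, 'n) chart \<Rightarrow> 'a \<Rightarrow> real ^ 'n \<Rightarrow> real ^ 'n" where
  "transition_deriv c d p = frechet_derivative (snd d \<circ> chart_inv c) (at (snd c p))"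

definition riemannian_manifold :: "('a, 'n::finite) riem \<Rightarrow> bool" where
  "riemannian_manifold M \<longleftrightarrow>
     smooth_atlas (mtop M) (atlas M) \<and>
     (\<forall>c\<in>atlas M. \<forall>p\<in>fst c. bilinear (gmetric M c p) \<and>
        (\<forall>v w. gmetric M c p v w = gmetric M c p w v) \<and>
        (\<forall>v. v \<noteq> 0 \<longrightarrow> 0 < gmetric M c p v v)) \<and>
     (\<forall>c\<in>atlas M. \<forall>v w. smooth_on (snd c ` fst c) (\<lambda>x. gmetric M c (chart_inv c x) v w)) \<and>
     (\<forall>c\<in>atlas M. \<forall>d\<in>atlas M. \<forall>p\<in>fst c \<inter> fst d. \<forall>v w.
        gmetric M c p v w = gmetric M d p (transition_deriv c d p v) (transition_deriv c d p w))"

definition borel_of :: "'a topology \<Rightarrow> 'a measure" where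
  "borel_of X = sigma (topspace X) {U. openin X U}"

text \<open>The Riemannian measure has density \<open>sqrt (det (g\<^sub>i\<^sub>j))\<close> in every chart.\<close>

definition riemannian_measure :: "('a, 'n::finite) riem \<Rightarrow> 'a measure \<Rightarrow> bool" where
  "riemannian_measure M \<mu> \<longleftrightarrow>
     sets \<mu> = sets (borel_of (mtop M)) \<and>
     (\<forall>c\<in>atlas M. \<forall>S\<in>sets \<mu>. S \<subseteq> fst c \<longrightarrow>
        emeasure \<mu> S = (\<integral>\<^sup>+x\<in>snd c ` S.
          ennreal (sqrt (det (\<chi> i j. gmetric M c (chart_inv c x) (axis i 1) (axis j 1)))) \<partial>lborel))"

subsection \<open>Smooth functions and maps\<close>

definition smooth_fun_on :: "('a, 'n::finite) riem \<Rightarrow> 'a set \<Rightarrow> ('a \<Rightarrow> real) \<Rightarrow> bool" where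
  "smooth_fun_on M U f \<longleftrightarrow> (\<forall>c\<in>atlas M. smooth_on (chart_image c U) (f \<circ> chart_inv c))"

definition dfun :: "('a, 'n::finite) chart \<Rightarrow> ('a \<Rightarrow> real) \<Rightarrow> 'a \<Rightarrow> real ^ 'n \<Rightarrow> real" where
  "dfun c f p = frechet_derivative (f \<circ> chart_inv c) (at (snd c p))"

definition smooth_map :: "('a, 'n::finite) riem \<Rightarrow> ('b, 'm::finite) riem \<Rightarrow> ('a \<Rightarrow> 'b) \<Rightarrow> bool" where
  "smooth_map M N f \<longleftrightarrow> continuous_map (mtop M) (mtop N) f \<and>
     (\<forall>c\<in>atlas M. \<forall>d\<in>atlas N.
        smooth_on (chart_image c (f -` fst d)) (snd d \<circ> f \<circ> chart_inv c))"

definition submersion :: "('a, 'n::finite) riem \<Rightarrow> ('b, 'm::finite) riem \<Rightarrow> ('a \<Rightarrow> 'b) \<Rightarrow> bool" where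
  "submersion M N f \<longleftrightarrow> smooth_map M N f \<and>
     (\<forall>c\<in>atlas M. \<forall>d\<in>atlas N. \<forall>p\<in>fst c. f p \<in> fst d \<longrightarrow>
        surj (frechet_derivative (snd d \<circ> f \<circ> chart_inv c) (at (snd c p))))"

text \<open>Smoothness of the boundary: locally \<open>\<Omega>\<close> is a sublevel set of a function without critical points.\<close>

definition smooth_boundary :: "('a, 'n::finite) riem \<Rightarrow> 'a set \<Rightarrow> bool" where
  "smooth_boundary M \<Omega> \<longleftrightarrow> (\<forall>p \<in> mtop M frontier_of \<Omega>. \<exists>U f. openin (mtop M) U \<and> p \<in> U \<and>
     smooth_fun_on M U f \<and>
     (\<forall>c\<in>atlas M. \<forall>q\<in>fst c \<inter> U. \<exists>v. dfun c f q v \<noteq> 0) \<and>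
     \<Omega> \<inter> U = {q \<in> U. f q < 0})"

section \<open>Flat tori and their Haar measure\<close>

definition plane_lattice :: "(real ^ 2) set \<Rightarrow> bool" where
  "plane_lattice \<Lambda> \<longleftrightarrow> (\<exists>a b. a \<noteq> b \<and> independent {a, b} \<and>
     \<Lambda> = {of_int m *\<^sub>R a + of_int n *\<^sub>R b | m n. True})"

text \<open>
  \<open>e\<close> induces an isometry of the flat torus \<open>\<real>\<^sup>2 / \<Lambda>\<close> onto \<open>F\<close>, where \<open>F\<close> carries the Riemannian
  metric induced from the ambient manifold \<open>M\<close>.
\<close>

definition flat_torus_uniformization ::
    "('a, 'n::finite) riem \<Rightarrow> 'a set \<Rightarrow> (real ^ 2) set \<Rightarrow> (real ^ 2 \<Rightarrow> 'a) \<Rightarrow> bool" where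
  "flat_torus_uniformization M F \<Lambda> e \<longleftrightarrow>
     plane_lattice \<Lambda> \<and> range e = F \<and> (\<forall>x y. e x = e y \<longleftrightarrow> x - y \<in> \<Lambda>) \<and>
     continuous_map euclidean (mtop M) e \<and>
     (\<forall>c\<in>atlas M. smooth_on (e -` fst c) (snd c \<circ> e) \<and>
        (\<forall>x\<in>e -` fst c. \<forall>v w.
           gmetric M c (e x) (frechet_derivative (snd c \<circ> e) (at x) v)
                             (frechet_derivative (snd c \<circ> e) (at x) w) = v \<bullet> w))"

definition flat_torus :: "('a, 'n::finite) riem \<Rightarrow> 'a set \<Rightarrow> bool" where
  "flat_torus M F \<longleftrightarrow> (\<exists>\<Lambda> e. flat_torus_uniformization M F \<Lambda> e)"

text \<open>
  Translation by \<open>a\<close> maps \<open>e x\<close> to \<open>e (x + a)\<close>. Two uniformizations differ by a rigid motion of the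
  plane, so the group of translations of \<open>F\<close>, and hence the Haar measure, does not depend on \<open>e\<close>.
\<close>

definition torus_haar_measure :: "('a, 'n::finite) riem \<Rightarrow> 'a set \<Rightarrow> 'a measure \<Rightarrow> bool" where
  "torus_haar_measure M F \<theta> \<longleftrightarrow> (\<exists>\<Lambda> e. flat_torus_uniformization M F \<Lambda> e \<and>
     prob_space \<theta> \<and> sets \<theta> = sets (borel_of (subtopology (mtop M) F)) \<and>
     (\<forall>a. \<forall>S\<in>sets \<theta>. emeasure \<theta> ((\<lambda>x. e (x + a)) ` (e -` S)) = emeasure \<theta> S))"

section \<open>Square integrable functions\<close>

text \<open>
  Elements of \<open>L\<^sup>2\<close> are represented by functions; operators act on representatives, and all
  statements about them are up to null sets.
\<close>

definition L2 :: "'a measure \<Rightarrow> ('a \<Rightarrow> real) set" where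
  "L2 N = {u \<in> borel_measurable N. integrable N (\<lambda>x. (u x)\<^sup>2)}"

definition L2_norm :: "'a measure \<Rightarrow> ('a \<Rightarrow> real) \<Rightarrow> real" where
  "L2_norm N u = sqrt (\<integral>x. (u x)\<^sup>2 \<partial>N)"

definition L2_opnorm :: "'a measure \<Rightarrow> (('a \<Rightarrow> real) \<Rightarrow> 'a \<Rightarrow> real) \<Rightarrow> ereal" where
  "L2_opnorm N T = (SUP u\<in>L2 N. ereal (L2_norm N (T u) / L2_norm N u))"

definition L2_unitary ::
    "'a measure \<Rightarrow> 'b measure \<Rightarrow> (('a \<Rightarrow> real) \<Rightarrow> 'b \<Rightarrow> real) \<Rightarrow> bool" where
  "L2_unitary N N' U \<longleftrightarrow>
     (\<forall>u\<in>L2 N. U u \<in> L2 N' \<and> L2_norm N' (U u) = L2_norm N u) \<and>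
     (\<forall>u\<in>L2 N. \<forall>v\<in>L2 N. AE y in N'. U (\<lambda>x. u x + v x) y = U u y + U v y) \<and>
     (\<forall>u\<in>L2 N. \<forall>r. AE y in N'. U (\<lambda>x. r * u x) y = r * U u y) \<and>
     (\<forall>f\<in>L2 N'. \<exists>u\<in>L2 N. AE y in N'. U u y = f y)"

section \<open>The Dirichlet Laplacian\<close>

text \<open>
  A tangent field \<open>Z\<close> is given by its coordinates \<open>Z c p\<close> at \<open>p\<close> in each chart \<open>c\<close>.
\<close>

definition tangent_field ::
    "('a, 'n::finite) riem \<Rightarrow> 'a measure \<Rightarrow> (('a, 'n) chart \<Rightarrow> 'a \<Rightarrow> real ^ 'n) \<Rightarrow> bool" where
  "tangent_field M N Z \<longleftrightarrow>
     (\<forall>c\<in>atlas M. Z c \<in> borel_measurable (restrict_space N (fst c))) \<and>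
     (\<forall>c\<in>atlas M. \<forall>d\<in>atlas M. \<forall>p\<in>fst c \<inter> fst d \<inter> space N.
        Z d p = transition_deriv c d p (Z c p))"

text \<open>The value does not depend on the choice of the chart, by the transformation laws.\<close>

definition ginner :: "('a, 'n::finite) riem \<Rightarrow> (('a, 'n) chart \<Rightarrow> 'a \<Rightarrow> real ^ 'n)
    \<Rightarrow> (('a, 'n) chart \<Rightarrow> 'a \<Rightarrow> real ^ 'n) \<Rightarrow> 'a \<Rightarrow> real" where
  "ginner M Z W p = (let c = (SOME c. c \<in> atlas M \<and> p \<in> fst c) in gmetric M c p (Z c p) (W c p))"

definition grad :: "('a, 'n::finite) riem \<Rightarrow> ('a \<Rightarrow> real) \<Rightarrow> ('a, 'n) chart \<Rightarrow> 'a \<Rightarrow> real ^ 'n" where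
  "grad M f c p = (THE z. \<forall>v. gmetric M c p z v = dfun c f p v)"

definition test_functions :: "('a, 'n::finite) riem \<Rightarrow> 'a set \<Rightarrow> ('a \<Rightarrow> real) set" where
  "test_functions M \<Omega> = {f. smooth_fun_on M (topspace (mtop M)) f \<and>
     (\<exists>K. compactin (mtop M) K \<and> K \<subseteq> \<Omega> \<and> (\<forall>p\<in>topspace (mtop M) - K. f p = 0))}"

text \<open>
  \<open>H10_with_grad M \<mu> \<Omega> u Z\<close>: \<open>u\<close> is in \<open>H\<^sup>1\<^sub>0(\<Omega>)\<close>, the closure of \<open>C\<^sub>c\<^sup>\<infinity>(\<Omega>)\<close> in the \<open>H\<^sup>1\<close> norm,
  and \<open>Z\<close> is its (weak) gradient. For a given \<open>u\<close>, \<open>Z\<close> is unique almost everywhere.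
\<close>

definition H10_with_grad :: "('a, 'n::finite) riem \<Rightarrow> 'a measure \<Rightarrow> 'a set \<Rightarrow> ('a \<Rightarrow> real)
    \<Rightarrow> (('a, 'n) chart \<Rightarrow> 'a \<Rightarrow> real ^ 'n) \<Rightarrow> bool" where
  "H10_with_grad M \<mu> \<Omega> u Z \<longleftrightarrow> (let N = restrict_space \<mu> \<Omega> in
     u \<in> L2 N \<and> tangent_field M N Z \<and> integrable N (ginner M Z Z) \<and>
     (\<exists>\<phi> :: nat \<Rightarrow> 'a \<Rightarrow> real. (\<forall>k. \<phi> k \<in> test_functions M \<Omega>) \<and>
        (\<lambda>k. L2_norm N (\<lambda>x. \<phi> k x - u x)) \<longlonglongrightarrow> 0 \<and>
        (\<lambda>k. let Y = (\<lambda>c p. grad M (\<phi> k) c p - Z c p) in \<integral>x. ginner M Y Y x \<partial>N) \<longlonglongrightarrow> 0))"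

text \<open>
  The graph of the selfadjoint operator associated with the form \<open>E[u] = \<integral>\<bar>\<nabla>u\<bar>\<^sup>2\<close> on \<open>H\<^sup>1\<^sub>0(\<Omega>)\<close>:
  \<open>u \<in> dom H\<close> and \<open>H u = w\<close> iff \<open>E(u, v) = \<langle>w, v\<rangle>\<close> for all \<open>v\<close> in the form domain.
\<close>

definition dirichlet_laplacian ::
    "('a, 'n::finite) riem \<Rightarrow> 'a measure \<Rightarrow> 'a set \<Rightarrow> (('a \<Rightarrow> real) \<times> ('a \<Rightarrow> real)) set" where
  "dirichlet_laplacian M \<mu> \<Omega> = {(u, w). w \<in> L2 (restrict_space \<mu> \<Omega>) \<and>
     (\<exists>Z. H10_with_grad M \<mu> \<Omega> u Z \<and>
        (\<forall>v W. H10_with_grad M \<mu> \<Omega> v W \<longrightarrow>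
           (\<integral>x. ginner M Z W x \<partial>restrict_space \<mu> \<Omega>) = (\<integral>x. w x * v x \<partial>restrict_space \<mu> \<Omega>)))}"

section \<open>Heat semigroup and heat kernel\<close>

text \<open>
  \<open>T \<tau>\<close> is \<open>exp (-\<tau> H)\<close> in the sense of the functional calculus of the nonnegative selfadjoint
  operator with graph \<open>H\<close>, via the spectral theorem in multiplication operator form:
  a unitary \<open>U\<close> transforms \<open>H\<close> into multiplication by the spectral variable \<open>\<lambda> \<ge> 0\<close>
  on \<open>L\<^sup>2(\<nat> \<times> \<real>, \<nu>)\<close>, and \<open>T \<tau>\<close> into multiplication by \<open>exp (-\<tau> \<lambda>)\<close>. The factor \<open>\<nat>\<close> accounts for
  multiplicity, and is large enough because the \<open>L\<^sup>2\<close> spaces in question are separable.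
\<close>

definition heat_semigroup :: "'a measure \<Rightarrow> (('a \<Rightarrow> real) \<times> ('a \<Rightarrow> real)) set
    \<Rightarrow> (real \<Rightarrow> ('a \<Rightarrow> real) \<Rightarrow> 'a \<Rightarrow> real) \<Rightarrow> bool" where
  "heat_semigroup N H T \<longleftrightarrow> (\<exists>(\<nu> :: (nat \<times> real) measure) U.
     sigma_finite_measure \<nu> \<and> sets \<nu> = sets borel \<and> (AE z in \<nu>. 0 \<le> snd z) \<and>
     L2_unitary N \<nu> U \<and>
     (\<forall>u\<in>L2 N. \<forall>w\<in>L2 N. (u, w) \<in> H \<longleftrightarrow> (AE z in \<nu>. U w z = snd z * U u z)) \<and>
     (\<forall>\<tau>>0. \<forall>u\<in>L2 N. T \<tau> u \<in> L2 N \<and> (AE z in \<nu>. U (T \<tau> u) z = exp (- \<tau> * snd z) * U u z)))"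

definition heat_kernel :: "'a measure \<Rightarrow> (real \<Rightarrow> ('a \<Rightarrow> real) \<Rightarrow> 'a \<Rightarrow> real)
    \<Rightarrow> ('a \<Rightarrow> 'a \<Rightarrow> real \<Rightarrow> real) \<Rightarrow> bool" where
  "heat_kernel N T K \<longleftrightarrow> (\<forall>\<tau>>0.
     (\<lambda>(x, y). K x y \<tau>) \<in> L2 (N \<Otimes>\<^sub>M N) \<and>
     (AE (x, y) in N \<Otimes>\<^sub>M N. K x y \<tau> = K y x \<tau>) \<and>
     (\<forall>u\<in>L2 N. AE x in N. T \<tau> u x = (\<integral>y. K x y \<tau> * u y \<partial>N)))"

section \<open>Collapsing torus fibrations\<close>

text \<open>
  The disintegration formula includes that its right-hand side makes sense, i.e. that the inner
  integral exists for almost every \<open>b\<close> and the outer one exists.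
\<close>

definition normalized_disintegration :: "'b measure \<Rightarrow> 'x measure \<Rightarrow> ('b \<Rightarrow> 'x measure)
    \<Rightarrow> ('b \<Rightarrow> real) \<Rightarrow> ('x \<Rightarrow> real) \<Rightarrow> bool" where
  "normalized_disintegration NB N \<theta> A \<rho> \<longleftrightarrow>
     A \<in> borel_measurable NB \<and> (\<forall>b\<in>space NB. 0 < A b) \<and>
     \<rho> \<in> borel_measurable N \<and> (\<forall>x\<in>space N. 0 < \<rho> x) \<and>
     (\<forall>f :: 'x \<Rightarrow> real. integrable N f \<longrightarrow>
        (AE b in NB. integrable (\<theta> b) (\<lambda>x. f x * \<rho> x)) \<and>
        integrable NB (\<lambda>b. A b * (\<integral>x. f x * \<rho> x \<partial>\<theta> b)) \<and>
        (\<integral>x. f x \<partial>N) = (\<integral>b. A b * (\<integral>x. f x * \<rho> x \<partial>\<theta> b) \<partial>NB)) \<and>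
     (\<forall>b\<in>space NB. (\<integral>x. \<rho> x \<partial>\<theta> b) = 1)"

definition lift_op :: "('x \<Rightarrow> 'b) \<Rightarrow> ('b \<Rightarrow> real) \<Rightarrow> ('b \<Rightarrow> real) \<Rightarrow> 'x \<Rightarrow> real" where
  "lift_op \<pi> A v x = A (\<pi> x) powr (-1/2) * v (\<pi> x)"

definition push_op ::
    "('b \<Rightarrow> 'x measure) \<Rightarrow> ('b \<Rightarrow> real) \<Rightarrow> ('x \<Rightarrow> real) \<Rightarrow> ('x \<Rightarrow> real) \<Rightarrow> 'b \<Rightarrow> real" where
  "push_op \<theta> A \<rho> u b = A b powr (1/2) * (\<integral>x. u x * \<rho> x \<partial>\<theta> b)"

text \<open>
  \<open>\<pi> t\<close> is the projection \<open>X\<^sub>t \<rightarrow> B\<^sub>r\<^sub>e\<^sub>g = B - D\<close>; the fibres being surfaces, \<open>X\<^sub>t\<close> has dimension 4.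
  \<open>\<mu> t\<close> and \<open>\<mu>B\<close> are measures on all of \<open>X\<^sub>t\<close> and \<open>B\<close>; \<open>N t\<close> and \<open>NB\<close> are their restrictions to
  \<open>X\<^sub>t\<^sub>,\<^sub>0\<close> and \<open>B\<^sub>0\<close>. \<open>T t \<tau>\<close> and \<open>TB \<tau>\<close> are the heat operators.
\<close>

locale torus_collapse =
  fixes B :: "('b, 2) riem" and D :: "'b set" and B0 :: "'b set"
    and t0 :: real
    and X :: "real \<Rightarrow> ('x, 4) riem" and \<pi> :: "real \<Rightarrow> 'x \<Rightarrow> 'b"
    and s :: "real \<Rightarrow> real"
    and \<mu>B :: "'b measure" and \<mu> :: "real \<Rightarrow> 'x measure"
    and \<theta> :: "real \<Rightarrow> 'b \<Rightarrow> 'x measure"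
    and A :: "real \<Rightarrow> 'b \<Rightarrow> real" and \<rho> :: "real \<Rightarrow> 'x \<Rightarrow> real"
    and TB :: "real \<Rightarrow> ('b \<Rightarrow> real) \<Rightarrow> 'b \<Rightarrow> real"
    and T :: "real \<Rightarrow> real \<Rightarrow> ('x \<Rightarrow> real) \<Rightarrow> 'x \<Rightarrow> real"
    and KB :: "'b \<Rightarrow> 'b \<Rightarrow> real \<Rightarrow> real"
    and K :: "real \<Rightarrow> 'x \<Rightarrow> 'x \<Rightarrow> real \<Rightarrow> real"
    and X0 :: "real \<Rightarrow> 'x set" and NB :: "'b measure" and N :: "real \<Rightarrow> 'x measure"
  defines "X0 \<equiv> \<lambda>t. {x \<in> topspace (mtop (X t)). \<pi> t x \<in> B0}"
    and "NB \<equiv> restrict_space \<mu>B B0"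
    and "N \<equiv> \<lambda>t. restrict_space (\<mu> t) (X0 t)"
  assumes surface: "riemannian_manifold B" "riemannian_measure B \<mu>B"
    and D: "finite D" "D \<subseteq> topspace (mtop B)"
    and t0: "0 < t0"
    and total_space: "\<And>t. t \<in> {0<..t0} \<Longrightarrow> riemannian_manifold (X t)"
      "\<And>t. t \<in> {0<..t0} \<Longrightarrow> riemannian_measure (X t) (\<mu> t)"
    and projection: "\<And>t. t \<in> {0<..t0} \<Longrightarrow> submersion (X t) B (\<pi> t)"
      "\<And>t. t \<in> {0<..t0} \<Longrightarrow> \<pi> t ` topspace (mtop (X t)) = topspace (mtop B) - D"
    and fibres: "\<And>t b. t \<in> {0<..t0} \<Longrightarrow> b \<in> topspace (mtop B) - D \<Longrightarrow>
      flat_torus (X t) {x \<in> topspace (mtop (X t)). \<pi> t x = b}"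
    and B0: "openin (mtop B) B0" "connectedin (mtop B) B0" "B0 \<noteq> {}"
      "compactin (mtop B) (mtop B closure_of B0)" "mtop B closure_of B0 \<subseteq> topspace (mtop B) - D"
      "smooth_boundary B B0"
    and scale: "\<And>t. t \<in> {0<..t0} \<Longrightarrow> 0 < s t" "(s \<longlongrightarrow> 0) (at_right 0)"
    and haar: "\<And>t b. t \<in> {0<..t0} \<Longrightarrow> b \<in> topspace (mtop B) - D \<Longrightarrow>
      torus_haar_measure (X t) {x \<in> topspace (mtop (X t)). \<pi> t x = b} (\<theta> t b)"
    and disintegration: "\<And>t. t \<in> {0<..t0} \<Longrightarrow>
      normalized_disintegration NB (N t) (\<theta> t) (A t) (\<rho> t)"
    and heat_B: "heat_semigroup NB (dirichlet_laplacian B \<mu>B B0) TB"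
    and heat: "\<And>t. t \<in> {0<..t0} \<Longrightarrow>
      heat_semigroup (N t) (dirichlet_laplacian (X t) (\<mu> t) (X0 t)) (T t)"
    and kernel_B: "heat_kernel NB TB KB"
    and kernel: "\<And>t. t \<in> {0<..t0} \<Longrightarrow> heat_kernel (N t) (T t) (K t)"

text \<open>\<open>S\<^sub>t(\<tau>) = P\<^sub>t exp (-\<tau> H\<^sub>t) I\<^sub>t\<close>; the argument \<open>T\<close> is the heat semigroup of \<open>H\<^sub>t\<close> for a fixed \<open>t\<close>.\<close>

definition compressed_heat_op :: "('x \<Rightarrow> 'b) \<Rightarrow> ('b \<Rightarrow> 'x measure) \<Rightarrow> ('b \<Rightarrow> real) \<Rightarrow> ('x \<Rightarrow> real)
    \<Rightarrow> (real \<Rightarrow> ('x \<Rightarrow> real) \<Rightarrow> 'x \<Rightarrow> real) \<Rightarrow> real \<Rightarrow> ('b \<Rightarrow> real) \<Rightarrow> 'b \<Rightarrow> real" where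
  "compressed_heat_op \<pi> \<theta> A \<rho> T \<tau> v = push_op \<theta> A \<rho> (T \<tau> (lift_op \<pi> A v))"

end

theory Submission
  imports Defs
begin

text \<open>
  \<open>P\<^sub>t\<close> is the adjoint of \<open>I\<^sub>t\<close>, so by Fubini the kernel pairings in (K) are \<open>\<langle>\<Phi>, S\<^sub>t(\<tau>) \<Psi>\<rangle>\<close> and
  \<open>\<langle>\<Phi>, exp (-\<tau> H\<^sub>B) \<Psi>\<rangle>\<close>: (K) says that \<open>S\<^sub>t(\<tau>)\<close> converges weakly, and (S) implies (K). Conversely
  \<open>S\<^sub>t(\<tau>)\<close> is symmetric, so \<open>\<parallel>S\<^sub>t(\<tau>) v\<parallel>\<^sup>2 = \<langle>v, S\<^sub>t(\<tau>) S\<^sub>t(\<tau>) v\<rangle>\<close>, which by the almost semigroup property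
  is close to \<open>\<langle>v, S\<^sub>t(2\<tau>) v\<rangle>\<close> and so tends to \<open>\<langle>v, exp (-2\<tau> H\<^sub>B) v\<rangle> = \<parallel>exp (-\<tau> H\<^sub>B) v\<parallel>\<^sup>2\<close>. Weak
  convergence together with convergence of the norms is strong convergence.
\<close>

section \<open>Square integrable functions\<close>

lemma L2_measurable: "u \<in> L2 N \<Longrightarrow> u \<in> borel_measurable N"
  by (simp add: L2_def)

lemma L2_norm_nonneg [simp]: "0 \<le> L2_norm N u"
  by (simp add: L2_norm_def)

lemma L2_norm_power2: "(L2_norm N u)\<^sup>2 = (\<integral>x. (u x)\<^sup>2 \<partial>N)"
  by (simp add: L2_norm_def)

lemma L2_integrable_power2: "u \<in> L2 N \<Longrightarrow> integrable N (\<lambda>x. (u x)\<^sup>2)"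
  by (simp add: L2_def)

lemma L2_integrable_mult:
  assumes "u \<in> L2 N" "v \<in> L2 N"
  shows "integrable N (\<lambda>x. u x * v x)"
proof (rule Bochner_Integration.integrable_bound)
  note [measurable] = assms[THEN L2_measurable]
  show "integrable N (\<lambda>x. (u x)\<^sup>2 + (v x)\<^sup>2)"
    using assms by (simp add: L2_def)
  show "(\<lambda>x. u x * v x) \<in> borel_measurable N"
    by measurable
  have "\<bar>a * b\<bar> \<le> a\<^sup>2 + b\<^sup>2" for a b :: real
  proof -
    have "2 * (\<bar>a\<bar> * \<bar>b\<bar>) \<le> a\<^sup>2 + b\<^sup>2" "0 \<le> \<bar>a\<bar> * \<bar>b\<bar>"
      using sum_squares_bound[of "\<bar>a\<bar>" "\<bar>b\<bar>"] by simp_all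
    then show ?thesis
      unfolding abs_mult by linarith
  qed
  then show "AE x in N. norm (u x * v x) \<le> norm ((u x)\<^sup>2 + (v x)\<^sup>2)"
    by simp
qed

text \<open>The free scalar \<open>r\<close> covers three uses: \<open>r = 1\<close> for
  polarization, \<open>r = -1\<close> for differences, and arbitrary \<open>r\<close> for the
  quadratic polynomial behind Cauchy-Schwarz.\<close>

lemma L2_integral_add_power2:
  assumes "u \<in> L2 N" "v \<in> L2 N"
  shows "(\<integral>x. (u x + r * v x)\<^sup>2 \<partial>N) =
    (\<integral>x. (u x)\<^sup>2 \<partial>N) + 2 * r * (\<integral>x. u x * v x \<partial>N) + r\<^sup>2 * (\<integral>x. (v x)\<^sup>2 \<partial>N)"
    and "integrable N (\<lambda>x. (u x + r * v x)\<^sup>2)"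
proof -
  note int = assms[THEN L2_integrable_power2] L2_integrable_mult[OF assms]
  have eq: "(\<lambda>x. (u x + r * v x)\<^sup>2) = (\<lambda>x. (u x)\<^sup>2 + 2 * r * (u x * v x) + r\<^sup>2 * (v x)\<^sup>2)"
    by (simp add: fun_eq_iff power2_eq_square algebra_simps)
  show "integrable N (\<lambda>x. (u x + r * v x)\<^sup>2)"
    unfolding eq using int by simp
  show "(\<integral>x. (u x + r * v x)\<^sup>2 \<partial>N) =
    (\<integral>x. (u x)\<^sup>2 \<partial>N) + 2 * r * (\<integral>x. u x * v x \<partial>N) + r\<^sup>2 * (\<integral>x. (v x)\<^sup>2 \<partial>N)"
    unfolding eq using int by simp
qed

lemma L2_add_scaled:
  assumes "u \<in> L2 N" "v \<in> L2 N"
  shows "(\<lambda>x. u x + r * v x) \<in> L2 N"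
  using L2_integral_add_power2(2)[OF assms] assms[THEN L2_measurable] by (auto simp: L2_def)

lemma L2_diff: "u \<in> L2 N \<Longrightarrow> v \<in> L2 N \<Longrightarrow> (\<lambda>x. u x - v x) \<in> L2 N"
  using L2_add_scaled[of u N v "-1"] by simp

lemma L2_norm_diff_power2:
  assumes "u \<in> L2 N" "v \<in> L2 N"
  shows "(L2_norm N (\<lambda>x. u x - v x))\<^sup>2 =
    (L2_norm N u)\<^sup>2 - 2 * (\<integral>x. u x * v x \<partial>N) + (L2_norm N v)\<^sup>2"
  using L2_integral_add_power2(1)[OF assms, of "-1"] by (simp add: L2_norm_power2)

text \<open>The integral of \<open>(u + r v)^2\<close> is a nonnegative quadratic polynomial in
  \<open>r\<close>, so its discriminant is not positive.\<close>

lemma L2_Cauchy_Schwarz: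
  assumes "u \<in> L2 N" "v \<in> L2 N"
  shows "\<bar>\<integral>x. u x * v x \<partial>N\<bar> \<le> L2_norm N u * L2_norm N v"
proof -
  define a b c where "a = (\<integral>x. (u x)\<^sup>2 \<partial>N)" and "b = (\<integral>x. u x * v x \<partial>N)"
    and "c = (\<integral>x. (v x)\<^sup>2 \<partial>N)"
  have "0 \<le> (\<integral>x. (u x + r * v x)\<^sup>2 \<partial>N)" for r
    by simp
  then have q: "0 \<le> a + 2 * r * b + r\<^sup>2 * c" for r
    using L2_integral_add_power2(1)[OF assms] by (simp add: a_def b_def c_def)
  have "0 \<le> c"
    by (simp add: c_def)
  have "b\<^sup>2 \<le> a * c"
  proof (cases "c = 0")
    case True
    have "b = 0"
    proof (rule ccontr)
      assume "b \<noteq> 0"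
      \<comment> \<open>For \<open>c = 0\<close> the polynomial is affine in \<open>r\<close>. This
        value of \<open>r\<close> would make it equal to \<open>-1\<close>.\<close>
      then have "2 * (- (a + 1) / (2 * b)) * b = - (a + 1)"
        by simp
      then show False
        using q[of "- (a + 1) / (2 * b)"] True by simp
    qed
    then show ?thesis
      using True by simp
  next
    case False
    then have "0 < c"
      using \<open>0 \<le> c\<close> by simp
    \<comment> \<open>The point \<open>- b / c\<close> is the minimizer of the quadratic
      polynomial.\<close>
    have "0 \<le> c * (a + 2 * (- b / c) * b + (- b / c)\<^sup>2 * c)"
      using q[of "- b / c"] \<open>0 < c\<close> by simp
    also have "\<dots> = a * c - b\<^sup>2"
      using \<open>0 < c\<close> by (simp add: field_simps power2_eq_square)
    finally show ?thesis
      by simp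
  qed
  then have "\<bar>b\<bar> \<le> sqrt (a * c)"
    using real_le_rsqrt by force
  then show ?thesis
    by (simp add: a_def b_def c_def L2_norm_def real_sqrt_mult)
qed

text \<open>Since division by \<open>0\<close> yields \<open>0\<close>, the quotients in
  \<open>L2_opnorm\<close> carry no information about functions of norm zero; these are excluded
  here.\<close>

lemma L2_opnorm_bound:
  assumes "u \<in> L2 N" "L2_opnorm N F \<le> ereal c" "L2_norm N u \<noteq> 0"
  shows "L2_norm N (F u) \<le> c * L2_norm N u"
proof -
  have "ereal (L2_norm N (F u) / L2_norm N u) \<le> ereal c"
    using assms(1,2) unfolding L2_opnorm_def SUP_le_iff by blast
  moreover have "0 < L2_norm N u"
    using assms(3) L2_norm_nonneg[of N u] by linarith
  ultimately show ?thesis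
    by (simp add: pos_divide_le_eq)
qed

text \<open>Polarization: the norms of \<open>u\<close>, \<open>v\<close> and \<open>u + v\<close>
  are preserved, and expanding the last square isolates the inner product. Additivity of
  \<open>U\<close> holds only almost everywhere, hence the passage through
  \<open>integral_cong_AE\<close>.\<close>

lemma L2_unitary_inner:
  assumes U: "L2_unitary N N' U" and u: "u \<in> L2 N" and v: "v \<in> L2 N"
  shows "(\<integral>x. U u x * U v x \<partial>N') = (\<integral>x. u x * v x \<partial>N)"
proof -
  have UL2: "U w \<in> L2 N'" and Unorm: "L2_norm N' (U w) = L2_norm N w" if "w \<in> L2 N" for w
    using U that by (auto simp: L2_unitary_def)
  have Usq: "(\<integral>x. (U w x)\<^sup>2 \<partial>N') = (\<integral>x. (w x)\<^sup>2 \<partial>N)" if "w \<in> L2 N" for w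
    using Unorm[OF that] by (metis L2_norm_power2)
  have uv: "(\<lambda>x. u x + v x) \<in> L2 N"
    using L2_add_scaled[OF u v, of 1] by simp
  have "(\<integral>x. (U (\<lambda>x. u x + v x) x)\<^sup>2 \<partial>N') = (\<integral>x. (U u x + U v x)\<^sup>2 \<partial>N')"
  proof (rule integral_cong_AE)
    note [measurable] = UL2[OF u, THEN L2_measurable] UL2[OF v, THEN L2_measurable]
      UL2[OF uv, THEN L2_measurable]
    show "(\<lambda>x. (U (\<lambda>x. u x + v x) x)\<^sup>2) \<in> borel_measurable N'"
      "(\<lambda>x. (U u x + U v x)\<^sup>2) \<in> borel_measurable N'"
      by measurable
    have "AE y in N'. U (\<lambda>x. u x + v x) y = U u y + U v y"
      using U u v by (auto simp: L2_unitary_def)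
    then show "AE x in N'. (U (\<lambda>x. u x + v x) x)\<^sup>2 = (U u x + U v x)\<^sup>2"
      by eventually_elim simp
  qed
  then have "(\<integral>x. (U u x + 1 * U v x)\<^sup>2 \<partial>N') = (\<integral>x. (u x + 1 * v x)\<^sup>2 \<partial>N)"
    using Usq[OF uv] by simp
  then show ?thesis
    unfolding L2_integral_add_power2(1)[OF u v] L2_integral_add_power2(1)[OF UL2[OF u] UL2[OF v]]
    using Usq[OF u] Usq[OF v] by simp
qed

text \<open>Monotone convergence along integrable truncations of \<open>f\<close>. The
  disintegration formula speaks only about functions already known to be integrable; this criterion
  derives integrability from bounds on such functions alone.\<close>

lemma integrable_of_bounded_minorants:
  fixes f :: "'a \<Rightarrow> real"
  assumes "sigma_finite_measure M" and f [measurable]: "f \<in> borel_measurable M"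
    and nonneg: "\<And>x. 0 \<le> f x"
    and bound: "\<And>g. integrable M g \<Longrightarrow> (\<And>x. 0 \<le> g x) \<Longrightarrow> (\<And>x. g x \<le> f x) \<Longrightarrow> (\<integral>x. g x \<partial>M) \<le> c"
  shows "integrable M f"
proof -
  interpret sigma_finite_measure M by fact
  obtain h :: "'a \<Rightarrow> real" where h [measurable]: "h \<in> borel_measurable M" and h_pos: "\<And>x. h x > 0"
    and "\<And>x. h x \<le> 1" and h_int: "integrable M h"
    by (rule obtain_positive_integrable_function) (rule that, assumption+)
  \<comment> \<open>Cutting at multiples of a strictly positive integrable \<open>h\<close> keeps
    \<open>g n\<close> integrable even on a space of infinite measure. At each point the cut is
    inactive for large \<open>n\<close>.\<close>
  define g where "g n x = min (f x) (real n * h x)" for n x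
  have [measurable]: "g n \<in> borel_measurable M" for n
    unfolding g_def by measurable
  have g_nonneg: "0 \<le> g n x" and g_le: "g n x \<le> f x" for n x
    using nonneg[of x] h_pos[of x] by (auto simp: g_def)
  have g_int: "integrable M (g n)" for n
  proof (rule Bochner_Integration.integrable_bound)
    show "integrable M (\<lambda>x. real n * h x)"
      using h_int by simp
    show "AE x in M. norm (g n x) \<le> norm (real n * h x)"
    proof (intro AE_I2)
      fix x
      have "g n x \<le> real n * h x"
        by (simp add: g_def)
      then show "norm (g n x) \<le> norm (real n * h x)"
        using g_nonneg[of n x] by simp
    qed
  qed measurable
  have mono: "mono (\<lambda>n. g n x)" for x
  proof (rule monoI)
    fix m n :: nat
    assume "m \<le> n"
    then have "real m * h x \<le> real n * h x"
      using h_pos[of x] by (intro mult_right_mono) auto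
    then show "g m x \<le> g n x"
      by (auto simp: g_def)
  qed
  have lim: "(\<lambda>n. g n x) \<longlonglongrightarrow> f x" for x
  proof (rule tendsto_eventually)
    obtain n where "f x / h x < real n"
      using reals_Archimedean2 by blast
    then have "f x \<le> real m * h x" if "n \<le> m" for m
    proof -
      have "f x / h x \<le> real m"
        using \<open>f x / h x < real n\<close> that by simp
      then show ?thesis
        using h_pos[of x] by (simp add: pos_divide_le_eq)
    qed
    then show "\<forall>\<^sub>F n in sequentially. g n x = f x"
      unfolding eventually_sequentially g_def by (intro exI[of _ n] allI impI min_absorb1)
  qed
  have "incseq (\<lambda>n. integral\<^sup>L M (g n))"
    using mono by (intro incseq_SucI integral_mono g_int) (auto simp: mono_iff_le_Suc)
  then obtain l where "(\<lambda>n. integral\<^sup>L M (g n)) \<longlonglongrightarrow> l"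
    using incseq_convergent[of "\<lambda>n. integral\<^sup>L M (g n)" c] bound[OF g_int g_nonneg g_le] by blast
  then show ?thesis
    using integrable_monotone_convergence[of M g f l] g_int mono lim by simp
qed

section \<open>Heat semigroups and heat kernels\<close>

lemma heat_semigroup_L2:
  "heat_semigroup N H T \<Longrightarrow> 0 < \<tau> \<Longrightarrow> u \<in> L2 N \<Longrightarrow> T \<tau> u \<in> L2 N"
  by (auto simp: heat_semigroup_def)

text \<open>Under the spectral unitary \<open>U\<close>, \<open>T \<tau>\<close> becomes
  multiplication by a real exponential, which can be moved between the factors of an inner product,
  and exponents add. Taking \<open>\<sigma> = \<tau>\<close> and \<open>u = v\<close> in the first
  part gives the squared norm of \<open>T \<tau> v\<close>.\<close>

lemma heat_semigroup_inner:
  assumes "heat_semigroup N H T" "0 < \<sigma>" "0 < \<tau>" "u \<in> L2 N" "v \<in> L2 N"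
  shows "(\<integral>x. T \<sigma> u x * T \<tau> v x \<partial>N) = (\<integral>x. u x * T (\<sigma> + \<tau>) v x \<partial>N)"
    and "(\<integral>x. T \<tau> u x * v x \<partial>N) = (\<integral>x. u x * T \<tau> v x \<partial>N)"
proof -
  note T = heat_semigroup_L2[OF assms(1)]
  obtain \<nu> :: "(nat \<times> real) measure" and U where sets_\<nu>: "sets \<nu> = sets borel"
    and U: "L2_unitary N \<nu> U"
    and UT: "\<And>\<tau> u. 0 < \<tau> \<Longrightarrow> u \<in> L2 N \<Longrightarrow> AE z in \<nu>. U (T \<tau> u) z = exp (- \<tau> * snd z) * U u z"
    using assms(1) unfolding heat_semigroup_def by (elim exE conjE) (rule that, blast+)
  note [measurable_cong] = sets_\<nu>
  have [measurable]: "snd \<in> borel_measurable (borel :: (nat \<times> real) measure)"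
    by (intro borel_measurable_continuous_onI continuous_intros)
  have U_meas: "U w \<in> borel_measurable \<nu>" if "w \<in> L2 N" for w
    using U that L2_measurable by (auto simp: L2_unitary_def)
  note [measurable] = U_meas[OF assms(4)] U_meas[OF assms(5)] U_meas[OF T[OF assms(2,4)]]
    U_meas[OF T[OF assms(3,4)]] U_meas[OF T[OF assms(3,5)]] U_meas[OF T[OF add_pos_pos[OF assms(2,3)] assms(5)]]
  note inner = L2_unitary_inner[OF U, symmetric]
  have "(\<integral>x. T \<sigma> u x * T \<tau> v x \<partial>N) = (\<integral>z. U (T \<sigma> u) z * U (T \<tau> v) z \<partial>\<nu>)"
    using assms T by (intro inner)
  also have "\<dots> = (\<integral>z. U u z * U (T (\<sigma> + \<tau>) v) z \<partial>\<nu>)"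
  proof (rule integral_cong_AE)
    show "AE z in \<nu>. U (T \<sigma> u) z * U (T \<tau> v) z = U u z * U (T (\<sigma> + \<tau>) v) z"
      using UT[OF assms(2,4)] UT[OF assms(3,5)] UT[OF add_pos_pos[OF assms(2,3)] assms(5)]
      by eventually_elim (simp add: ring_distribs mult_exp_exp)
  qed measurable
  also have "\<dots> = (\<integral>x. u x * T (\<sigma> + \<tau>) v x \<partial>N)"
    using assms T by (intro inner[symmetric]) auto
  finally show "(\<integral>x. T \<sigma> u x * T \<tau> v x \<partial>N) = (\<integral>x. u x * T (\<sigma> + \<tau>) v x \<partial>N)" .
  have "(\<integral>x. T \<tau> u x * v x \<partial>N) = (\<integral>z. U (T \<tau> u) z * U v z \<partial>\<nu>)"
    using assms T by (intro inner)
  also have "\<dots> = (\<integral>z. U u z * U (T \<tau> v) z \<partial>\<nu>)"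
  proof (rule integral_cong_AE)
    show "AE z in \<nu>. U (T \<tau> u) z * U v z = U u z * U (T \<tau> v) z"
      using UT[OF assms(3,4)] UT[OF assms(3,5)] by eventually_elim simp
  qed measurable
  also have "\<dots> = (\<integral>x. u x * T \<tau> v x \<partial>N)"
    using assms T by (intro inner[symmetric]) auto
  finally show "(\<integral>x. T \<tau> u x * v x \<partial>N) = (\<integral>x. u x * T \<tau> v x \<partial>N)" .
qed

lemma L2_tensor:
  assumes "sigma_finite_measure M" "sigma_finite_measure N" and u: "u \<in> L2 M" and v: "v \<in> L2 N"
  shows "(\<lambda>(x, y). u x * v y) \<in> L2 (M \<Otimes>\<^sub>M N)"
proof -
  interpret pair_sigma_finite M N
    using assms(1,2) by (simp add: pair_sigma_finite_def)
  note [measurable] = L2_measurable[OF u] L2_measurable[OF v]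
  have "integrable (M \<Otimes>\<^sub>M N) (\<lambda>(x, y). (u x)\<^sup>2 * (v y)\<^sup>2)"
    using L2_integrable_power2[OF u] L2_integrable_power2[OF v]
    by (intro Fubini_integrable) (auto simp: case_prod_beta')
  then show ?thesis
    by (simp add: L2_def case_prod_beta' power_mult_distrib)
qed

text \<open>The kernel and the tensor product of \<open>u\<close> and \<open>v\<close> are both
  square integrable on the product space, so their product is integrable and Fubini applies.\<close>

lemma heat_kernel_pairing:
  assumes N: "sigma_finite_measure N" and T: "heat_semigroup N H T" and K: "heat_kernel N T K"
    and "0 < \<tau>" and u: "u \<in> L2 N" and v: "v \<in> L2 N"
  shows "(\<integral>(x, y). K x y \<tau> * u x * v y \<partial>(N \<Otimes>\<^sub>M N)) = (\<integral>x. u x * T \<tau> v x \<partial>N)"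
proof -
  interpret pair_sigma_finite N N
    using N by (simp add: pair_sigma_finite_def)
  note Tv = heat_semigroup_L2[OF T \<open>0 < \<tau>\<close> v]
  note [measurable] = L2_measurable[OF u] L2_measurable[OF v] L2_measurable[OF Tv]
  have KL2: "(\<lambda>(x, y). K x y \<tau>) \<in> L2 (N \<Otimes>\<^sub>M N)"
    and KT: "AE x in N. T \<tau> v x = (\<integral>y. K x y \<tau> * v y \<partial>N)"
    using K \<open>0 < \<tau>\<close> v unfolding heat_kernel_def by auto
  have int: "integrable (N \<Otimes>\<^sub>M N) (\<lambda>z. K (fst z) (snd z) \<tau> * u (fst z) * v (snd z))"
    using L2_integrable_mult[OF KL2 L2_tensor[OF N N u v]] by (simp add: case_prod_beta' mult.assoc)
  have "(\<integral>(x, y). K x y \<tau> * u x * v y \<partial>(N \<Otimes>\<^sub>M N)) = (\<integral>x. (\<integral>y. K x y \<tau> * u x * v y \<partial>N) \<partial>N)"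
    using integral_fst'[OF int] by (simp add: case_prod_beta')
  also have "\<dots> = (\<integral>x. u x * T \<tau> v x \<partial>N)"
  proof (rule integral_cong_AE)
    show "(\<lambda>x. \<integral>y. K x y \<tau> * u x * v y \<partial>N) \<in> borel_measurable N"
      using borel_measurable_integrable[OF integrable_fst'[OF int]] by simp
    show "AE x in N. (\<integral>y. K x y \<tau> * u x * v y \<partial>N) = u x * T \<tau> v x"
      using KT
    proof eventually_elim
      fix x
      assume eq: "T \<tau> v x = (\<integral>y. K x y \<tau> * v y \<partial>N)"
      have "(\<integral>y. K x y \<tau> * u x * v y \<partial>N) = (\<integral>y. u x * (K x y \<tau> * v y) \<partial>N)"
        by (simp add: mult_ac)
      then show "(\<integral>y. K x y \<tau> * u x * v y \<partial>N) = u x * T \<tau> v x"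
        by (simp add: eq)
    qed
  qed measurable
  finally show ?thesis .
qed

section \<open>Riemannian measures\<close>

lemma space_borel_of: "space (borel_of X) = topspace X"
  by (simp add: borel_of_def space_measure_of_conv)

lemma openin_sets_borel_of: "openin X U \<Longrightarrow> U \<in> sets (borel_of X)"
  using openin_subset[of X] by (auto simp: borel_of_def sets_measure_of_conv intro: sigma_sets.Basic)

text \<open>The density is continuous in a chart, so every point has an open neighbourhood of finite
  measure. By second countability, the basic open sets of finite measure form a countable
  cover.\<close>

lemma sigma_finite_riemannian_measure:
  fixes M :: "('a, 'n::finite) riem"
  assumes M: "riemannian_manifold M" and \<mu>: "riemannian_measure M \<mu>"
  shows "sigma_finite_measure \<mu>"
proof -
  have sets_\<mu>: "sets \<mu> = sets (borel_of (mtop M))"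
    using \<mu> by (simp add: riemannian_measure_def)
  then have space_\<mu>: "space \<mu> = topspace (mtop M)"
    using sets_eq_imp_space_eq space_borel_of by metis
  have cover: "(\<Union>c\<in>atlas M. fst c) = topspace (mtop M)"
    and sc: "second_countable_space (mtop M)"
    and charts: "\<forall>c\<in>atlas M. openin (mtop M) (fst c) \<and> open (snd c ` fst c) \<and>
      homeomorphic_map (subtopology (mtop M) (fst c)) (top_of_set (snd c ` fst c)) (snd c)"
    and smooth: "\<forall>c\<in>atlas M. \<forall>v w. smooth_on (snd c ` fst c) (\<lambda>x. gmetric M c (chart_inv c x) v w)"
    using M unfolding riemannian_manifold_def smooth_atlas_def
    by - ((elim conjE, assumption)+)
  have density: "\<forall>c\<in>atlas M. \<forall>S\<in>sets \<mu>. S \<subseteq> fst c \<longrightarrow>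
      emeasure \<mu> S = (\<integral>\<^sup>+x\<in>snd c ` S.
        ennreal (sqrt (det (\<chi> i j. gmetric M c (chart_inv c x) (axis i 1) (axis j 1)))) \<partial>lborel)"
    using \<mu> unfolding riemannian_measure_def by (rule conjunct2)
  have nbhd: "\<exists>S. openin (mtop M) S \<and> p \<in> S \<and> emeasure \<mu> S < \<infinity>" if p: "p \<in> topspace (mtop M)" for p
  proof -
    obtain c where c: "c \<in> atlas M" "p \<in> fst c"
      using p cover by blast
    define W where "W = snd c ` fst c"
    have opens: "openin (mtop M) (fst c)" "open W"
      and homeo: "homeomorphic_map (subtopology (mtop M) (fst c)) (top_of_set W) (snd c)"
      using bspec[OF charts c(1)] by (simp_all add: W_def)
    define d where "d x = sqrt (det (\<chi> i j. gmetric M c (chart_inv c x) (axis i 1) (axis j 1)))" for x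
    \<comment> \<open>Order \<open>0\<close> of \<open>Ck_on\<close> is continuity.\<close>
    have "continuous_on W (\<lambda>x. gmetric M c (chart_inv c x) v w)" for v w
      using smooth[rule_format, OF c(1), of v w, unfolded smooth_on_def, THEN spec[of _ 0]]
      by (simp add: W_def)
    then have cont: "continuous_on W d"
      unfolding d_def det_def by (auto intro!: continuous_intros)
    \<comment> \<open>A closed ball is taken because compactness bounds the density there, while
      \<open>d\<close> may be unbounded towards the boundary of \<open>W\<close>.\<close>
    obtain e where e: "0 < e" "cball (snd c p) e \<subseteq> W"
      using opens(2) c(2) unfolding open_contains_cball W_def by blast
    have "bounded (d ` cball (snd c p) e)"
      using cont e(2) by (intro compact_imp_bounded compact_continuous_image)
        (auto intro: continuous_on_subset)
    then obtain C where C: "\<And>x. x \<in> cball (snd c p) e \<Longrightarrow> d x \<le> C"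
      unfolding bounded_iff by (metis abs_le_D1 imageI real_norm_def)
    define S where "S = {q \<in> fst c. snd c q \<in> ball (snd c p) e}"
    have "openin (top_of_set W) (ball (snd c p) e)"
      using e(2) by (intro open_subset) auto
    then have "openin (subtopology (mtop M) (fst c))
        {q \<in> topspace (subtopology (mtop M) (fst c)). snd c q \<in> ball (snd c p) e}"
      using homeomorphic_imp_continuous_map[OF homeo] openin_continuous_map_preimage by blast
    also have "topspace (subtopology (mtop M) (fst c)) = fst c"
      using openin_subset[OF opens(1)] by auto
    finally have S: "openin (mtop M) S"
      using openin_open_subtopology[OF opens(1)] unfolding S_def by blast
    have "emeasure \<mu> S = (\<integral>\<^sup>+x\<in>snd c ` S. d x \<partial>lborel)"
      using density[rule_format, OF c(1), of S] openin_sets_borel_of[OF S]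
      by (simp add: sets_\<mu> d_def) (simp add: S_def subset_iff)
    also have "\<dots> \<le> (\<integral>\<^sup>+x. ennreal C * indicator (cball (snd c p) e) x \<partial>lborel)"
      using C by (intro nn_integral_mono) (auto simp: S_def split: split_indicator intro!: ennreal_leI)
    also have "\<dots> = ennreal C * emeasure lborel (cball (snd c p) e)"
      by (simp add: nn_integral_cmult_indicator)
    also have "\<dots> < \<infinity>"
      using emeasure_bounded_finite[of "cball (snd c p) e"] by (simp add: ennreal_mult_less_top)
    finally show ?thesis
      using S c(2) e(1) by (auto simp: S_def)
  qed
  obtain \<B> where "countable \<B> \<and> (\<forall>V\<in>\<B>. openin (mtop M) V) \<and>
      (\<forall>U x. openin (mtop M) U \<and> x \<in> U \<longrightarrow> (\<exists>V\<in>\<B>. x \<in> V \<and> V \<subseteq> U))"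
    using sc unfolding second_countable_space_def by (rule exE)
  then have \<B>: "countable \<B>" "\<forall>V\<in>\<B>. openin (mtop M) V"
    "\<forall>U x. openin (mtop M) U \<and> x \<in> U \<longrightarrow> (\<exists>V\<in>\<B>. x \<in> V \<and> V \<subseteq> U)"
    by simp_all
  define \<C> where "\<C> = {V \<in> \<B>. emeasure \<mu> V \<noteq> \<infinity>}"
  show ?thesis
  proof
    have "\<exists>V\<in>\<C>. p \<in> V" if "p \<in> topspace (mtop M)" for p
    proof -
      obtain S where S: "openin (mtop M) S" "p \<in> S" "emeasure \<mu> S < \<infinity>"
        using nbhd \<open>p \<in> topspace (mtop M)\<close> by blast
      then obtain V where V: "V \<in> \<B>" "p \<in> V" "V \<subseteq> S"
        using \<B>(3) by blast
      then have "emeasure \<mu> V \<le> emeasure \<mu> S"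
        using openin_sets_borel_of[OF S(1)] by (intro emeasure_mono) (auto simp: sets_\<mu>)
      then show ?thesis
        using V S(3) unfolding \<C>_def by force
    qed
    moreover have "V \<subseteq> topspace (mtop M)" if "V \<in> \<C>" for V
      using that \<B>(2) openin_subset unfolding \<C>_def by blast
    ultimately have "\<Union>\<C> = space \<mu>"
      unfolding space_\<mu> by blast
    then show "\<exists>\<A>. countable \<A> \<and> \<A> \<subseteq> sets \<mu> \<and> \<Union>\<A> = space \<mu> \<and> (\<forall>a\<in>\<A>. emeasure \<mu> a \<noteq> \<infinity>)"
      using \<B>(1,2) unfolding sets_\<mu>
      by (intro exI[of _ \<C>]) (auto simp: \<C>_def intro!: openin_sets_borel_of)
  qed
qed

text \<open>Measurability is tested on the open generators of the Borel sets. This is applied to the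
  projections over \<open>B0\<close>.\<close>

lemma continuous_map_measurable_restrict:
  assumes "continuous_map X Y f" "sets M = sets (borel_of X)" "sets N = sets (borel_of Y)"
    "openin Y V"
  shows "f \<in> restrict_space M {x \<in> topspace X. f x \<in> V} \<rightarrow>\<^sub>M restrict_space N V"
proof -
  have sp: "space M = topspace X" "space N = topspace Y"
    using assms(2,3) sets_eq_imp_space_eq space_borel_of by metis+
  have "f \<in> M \<rightarrow>\<^sub>M sigma (topspace Y) {U. openin Y U}"
  proof (rule measurable_measure_of)
    show "{U. openin Y U} \<subseteq> Pow (topspace Y)"
      using openin_subset[of Y] by blast
    show "f \<in> space M \<rightarrow> topspace Y"
      using assms(1) by (auto simp: sp continuous_map_def)
    fix U
    assume "U \<in> {U. openin Y U}"
    then have "openin X {x \<in> topspace X. f x \<in> U}"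
      using assms(1) openin_continuous_map_preimage by blast
    moreover have "f -` U \<inter> space M = {x \<in> topspace X. f x \<in> U}"
      by (auto simp: sp)
    ultimately show "f -` U \<inter> space M \<in> sets M"
      using openin_sets_borel_of assms(2) by metis
  qed
  then have "f \<in> M \<rightarrow>\<^sub>M N"
    using assms(3) by (simp add: borel_of_def cong: measurable_cong_sets)
  then show ?thesis
    by (intro measurable_restrict_space2 measurable_restrict_space1) (auto simp: space_restrict_space)
qed

section \<open>Lift and push operators\<close>

text \<open>The measure-theoretic content of the setting at one fixed \<open>t\<close>. The geometry
  of the fibres enters only through \<open>fibre\<close>: the measure \<open>\<theta> b\<close>
  lives on the fibre over \<open>b\<close>.\<close>

locale disintegrated_fibration =
  fixes NB :: "'b measure" and N :: "'x measure" and \<pi> :: "'x \<Rightarrow> 'b" and \<theta> :: "'b \<Rightarrow> 'x measure"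
    and A :: "'b \<Rightarrow> real" and \<rho> :: "'x \<Rightarrow> real"
  assumes sigma_finite_base: "sigma_finite_measure NB"
    and sigma_finite_total: "sigma_finite_measure N"
    and projection_measurable [measurable]: "\<pi> \<in> N \<rightarrow>\<^sub>M NB"
    and fibre: "\<And>b x. b \<in> space NB \<Longrightarrow> x \<in> space (\<theta> b) \<Longrightarrow> x \<in> space N \<and> \<pi> x = b"
    and disintegration: "normalized_disintegration NB N \<theta> A \<rho>"
begin

lemma A_measurable [measurable]: "A \<in> borel_measurable NB"
  and A_pos: "b \<in> space NB \<Longrightarrow> 0 < A b"
  and \<rho>_pos: "x \<in> space N \<Longrightarrow> 0 < \<rho> x"
  and integral_\<rho>: "b \<in> space NB \<Longrightarrow> (\<integral>x. \<rho> x \<partial>\<theta> b) = 1"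
  using disintegration by (auto simp: normalized_disintegration_def)

lemma disintegration_integrable:
  fixes f :: "'x \<Rightarrow> real"
  shows "integrable N f \<Longrightarrow> integrable NB (\<lambda>b. A b * (\<integral>x. f x * \<rho> x \<partial>\<theta> b))"
  using disintegration by (auto simp: normalized_disintegration_def)

lemma disintegration_integral:
  fixes f :: "'x \<Rightarrow> real"
  shows "integrable N f \<Longrightarrow> (\<integral>x. f x \<partial>N) = (\<integral>b. A b * (\<integral>x. f x * \<rho> x \<partial>\<theta> b) \<partial>NB)"
  using disintegration by (auto simp: normalized_disintegration_def)

lemma lift_op_measurable:
  assumes [measurable]: "v \<in> borel_measurable NB"
  shows "lift_op \<pi> A v \<in> borel_measurable N"
  unfolding lift_op_def[abs_def] by measurable

lemma lift_op_fibre: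
  assumes "b \<in> space NB" "x \<in> space (\<theta> b)"
  shows "lift_op \<pi> A v x = v b / sqrt (A b)"
  using fibre[OF assms] A_pos[OF assms(1)]
  by (simp add: lift_op_def powr_minus_divide powr_half_sqrt)

text \<open>A function that is not integrable has integral \<open>0\<close> by default, whereas this
  integral is \<open>1\<close>.\<close>

lemma \<rho>_integrable: "b \<in> space NB \<Longrightarrow> integrable (\<theta> b) \<rho>"
  using integral_\<rho> not_integrable_integral_eq by fastforce

text \<open>The lift is constant on each fibre and \<open>\<rho>\<close> has total mass
  \<open>1\<close> there, so the weight \<open>A b\<close> cancels.\<close>

lemma lift_op_power2_bound:
  assumes b: "b \<in> space NB" and g: "\<And>x. g x \<le> (lift_op \<pi> A v x)\<^sup>2"
  shows "A b * (\<integral>x. g x * \<rho> x \<partial>\<theta> b) \<le> (v b)\<^sup>2"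
proof -
  have "(\<integral>x. g x * \<rho> x \<partial>\<theta> b) \<le> (\<integral>x. (v b)\<^sup>2 / A b * \<rho> x \<partial>\<theta> b)"
  \<comment> \<open>Only the majorant has to be integrable: if \<open>g x * \<rho> x\<close> is not
    integrable on the fibre, its integral is \<open>0\<close>, which lies below that of the
    nonnegative majorant.\<close>
  proof (rule integral_mono')
    show "integrable (\<theta> b) (\<lambda>x. (v b)\<^sup>2 / A b * \<rho> x)"
      using \<rho>_integrable[OF b] by simp
    fix x
    assume x: "x \<in> space (\<theta> b)"
    then have "0 < \<rho> x"
      using fibre[OF b] \<rho>_pos by blast
    moreover have "g x \<le> (v b)\<^sup>2 / A b"
      using g[of x] A_pos[OF b] by (simp add: lift_op_fibre[OF b x] power_divide)
    ultimately show "g x * \<rho> x \<le> (v b)\<^sup>2 / A b * \<rho> x"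
      by (intro mult_right_mono) auto
    show "0 \<le> (v b)\<^sup>2 / A b * \<rho> x"
      using A_pos[OF b] \<open>0 < \<rho> x\<close> by simp
  qed
  also have "\<dots> = (v b)\<^sup>2 / A b"
    using integral_\<rho>[OF b] by simp
  finally show ?thesis
    using A_pos[OF b] by (simp add: field_simps)
qed

lemma lift_op_integral_bound:
  assumes v: "v \<in> L2 NB" and g: "integrable N g" "\<And>x. g x \<le> (lift_op \<pi> A v x)\<^sup>2"
  shows "(\<integral>x. g x \<partial>N) \<le> (\<integral>b. (v b)\<^sup>2 \<partial>NB)"
  unfolding disintegration_integral[OF g(1)]
  using disintegration_integrable[OF g(1)] L2_integrable_power2[OF v] lift_op_power2_bound[OF _ g(2)]
  by (intro integral_mono) auto

text \<open>The disintegration formula cannot be applied to the square of the lift before that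
  square is known to be integrable, so its integrable minorants are bounded instead.\<close>

lemma lift_op_L2:
  assumes v: "v \<in> L2 NB"
  shows "lift_op \<pi> A v \<in> L2 N"
proof -
  note [measurable] = lift_op_measurable[OF L2_measurable[OF v]]
  have "integrable N (\<lambda>x. (lift_op \<pi> A v x)\<^sup>2)"
    using lift_op_integral_bound[OF v]
    by (intro integrable_of_bounded_minorants[OF sigma_finite_total]) auto
  then show ?thesis
    by (simp add: L2_def)
qed

lemma L2_norm_lift_op:
  assumes v: "v \<in> L2 NB"
  shows "L2_norm N (lift_op \<pi> A v) \<le> L2_norm NB v"
  unfolding L2_norm_def
  using lift_op_integral_bound[OF v L2_integrable_power2[OF lift_op_L2[OF v]]] by simp

section \<open>The push operator as adjoint of the lift operator\<close>

lemma push_op_fibre: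
  assumes b: "b \<in> space NB"
  shows "A b * (\<integral>x. u x * lift_op \<pi> A v x * \<rho> x \<partial>\<theta> b) = v b * push_op \<theta> A \<rho> u b"
proof -
  have "(\<integral>x. u x * lift_op \<pi> A v x * \<rho> x \<partial>\<theta> b) = (\<integral>x. v b / sqrt (A b) * (u x * \<rho> x) \<partial>\<theta> b)"
    by (intro Bochner_Integration.integral_cong) (simp_all add: lift_op_fibre[OF b])
  \<comment> \<open>Integrability on the fibre is known only for almost every \<open>b\<close>. The
    constant factor comes out in any case, because of the default value \<open>0\<close> of the
    integral.\<close>
  also have "\<dots> = v b / sqrt (A b) * (\<integral>x. u x * \<rho> x \<partial>\<theta> b)"
    by (rule integral_mult_right_zero)
  finally have "A b * (\<integral>x. u x * lift_op \<pi> A v x * \<rho> x \<partial>\<theta> b)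
      = v b * (A b / sqrt (A b) * (\<integral>x. u x * \<rho> x \<partial>\<theta> b))"
    by simp
  also have "A b / sqrt (A b) = A b powr (1/2)"
    using A_pos[OF b] by (simp add: powr_half_sqrt real_div_sqrt)
  finally show ?thesis
    by (simp add: push_op_def)
qed

lemma push_op_pairing:
  assumes u: "u \<in> L2 N" and v: "v \<in> L2 NB"
  shows "integrable NB (\<lambda>b. v b * push_op \<theta> A \<rho> u b)"
    and "(\<integral>b. v b * push_op \<theta> A \<rho> u b \<partial>NB) = (\<integral>x. u x * lift_op \<pi> A v x \<partial>N)"
proof -
  note int = L2_integrable_mult[OF u lift_op_L2[OF v]]
  show "integrable NB (\<lambda>b. v b * push_op \<theta> A \<rho> u b)"
    using disintegration_integrable[OF int] push_op_fibre
    by (simp cong: Bochner_Integration.integrable_cong)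
  show "(\<integral>b. v b * push_op \<theta> A \<rho> u b \<partial>NB) = (\<integral>x. u x * lift_op \<pi> A v x \<partial>N)"
    unfolding disintegration_integral[OF int]
    using push_op_fibre by (simp cong: Bochner_Integration.integral_cong)
qed

text \<open>The pairing yields measurability only after multiplication by a square integrable
  function. A strictly positive one, the square root of a positive integrable \<open>h\<close>, can
  be divided out again.\<close>

lemma push_op_measurable:
  assumes u: "u \<in> L2 N"
  shows "push_op \<theta> A \<rho> u \<in> borel_measurable NB"
proof -
  interpret sigma_finite_measure NB by (rule sigma_finite_base)
  obtain h :: "'b \<Rightarrow> real" where h [measurable]: "h \<in> borel_measurable NB" and h_pos: "\<And>x. h x > 0"
    and "\<And>x. h x \<le> 1" and h_int: "integrable NB h"
    by (rule obtain_positive_integrable_function) (rule that, assumption+)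
  have "(\<lambda>b. sqrt (h b)) \<in> L2 NB"
    using h_int h_pos by (simp add: L2_def less_imp_le)
  from push_op_pairing(1)[OF u this]
  have [measurable]: "(\<lambda>b. sqrt (h b) * push_op \<theta> A \<rho> u b) \<in> borel_measurable NB"
    by simp
  have "(\<lambda>b. sqrt (h b) * push_op \<theta> A \<rho> u b / sqrt (h b)) \<in> borel_measurable NB"
    by measurable
  moreover have "sqrt (h b) \<noteq> 0" for b
    using h_pos[of b] by simp
  ultimately show ?thesis
    by simp
qed

text \<open>Duality: a minorant \<open>g\<close> of \<open>(P u)\<^sup>2\<close> is tested against \<open>v = \<plusminus> sqrt g\<close>, with the sign of \<open>P u\<close>.\<close>

lemma push_op_L2:
  assumes u: "u \<in> L2 N"
  shows "push_op \<theta> A \<rho> u \<in> L2 NB"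
proof -
  define p where "p = push_op \<theta> A \<rho> u"
  have p [measurable]: "p \<in> borel_measurable NB"
    unfolding p_def by (rule push_op_measurable[OF u])
  have "integrable NB (\<lambda>b. (p b)\<^sup>2)"
  proof (rule integrable_of_bounded_minorants[OF sigma_finite_base])
    show "(\<integral>b. g b \<partial>NB) \<le> (L2_norm N u)\<^sup>2"
      if g: "integrable NB g" "\<And>b. 0 \<le> g b" "\<And>b. g b \<le> (p b)\<^sup>2" for g
    proof -
      define v where "v b = (if 0 \<le> p b then sqrt (g b) else - sqrt (g b))" for b
      have [measurable]: "g \<in> borel_measurable NB"
        using g(1) by simp
      have v_sq: "(v b)\<^sup>2 = g b" for b
        using g(2)[of b] by (simp add: v_def)
      have "v \<in> borel_measurable NB"
        unfolding v_def by measurable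
      then have v: "v \<in> L2 NB"
        using g(1) by (simp add: L2_def v_sq)
      have "(\<integral>b. g b \<partial>NB) \<le> (\<integral>b. v b * p b \<partial>NB)"
      proof (rule integral_mono)
        show "integrable NB (\<lambda>b. v b * p b)"
          unfolding p_def by (rule push_op_pairing(1)[OF u v])
        fix b
        have "sqrt (g b) * sqrt (g b) \<le> sqrt (g b) * \<bar>p b\<bar>"
          using g(2,3)[of b] by (intro mult_left_mono real_le_lsqrt) auto
        then show "g b \<le> v b * p b"
          using g(2)[of b] by (auto simp: v_def)
      qed (use g in simp)
      \<comment> \<open>Adjointness turns the pairing of \<open>v\<close> with \<open>P u\<close>
        into that of the lift of \<open>v\<close> with \<open>u\<close>.\<close>
      also have "\<dots> \<le> L2_norm N u * L2_norm N (lift_op \<pi> A v)"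
        using L2_Cauchy_Schwarz[OF u lift_op_L2[OF v]] push_op_pairing(2)[OF u v]
        by (simp add: p_def)
      also have "\<dots> \<le> L2_norm N u * L2_norm NB v"
        using L2_norm_lift_op[OF v] by (intro mult_left_mono) auto
      \<comment> \<open>Cancelling one factor \<open>L2_norm NB v\<close> leaves a bound independent
        of the minorant \<open>g\<close>.\<close>
      finally have "(L2_norm NB v)\<^sup>2 \<le> L2_norm N u * L2_norm NB v"
        by (simp add: L2_norm_power2 v_sq)
      then have "L2_norm NB v \<le> L2_norm N u"
        using L2_norm_nonneg[of NB v] L2_norm_nonneg[of N u]
        by (cases "L2_norm NB v = 0") (auto simp: power2_eq_square)
      then have "(L2_norm NB v)\<^sup>2 \<le> (L2_norm N u)\<^sup>2"
        by (intro power_mono) auto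
      then show ?thesis
        by (simp add: L2_norm_power2 v_sq)
    qed
  qed auto
  then show ?thesis
    using p by (simp add: L2_def p_def)
qed

section \<open>The compressed heat operator at fixed \<open>t\<close>\<close>

context
  fixes H T
  assumes heat: "heat_semigroup N H T"
begin

abbreviation "S \<equiv> compressed_heat_op \<pi> \<theta> A \<rho> T"

lemma compressed_heat_op_L2: "0 < \<tau> \<Longrightarrow> v \<in> L2 NB \<Longrightarrow> S \<tau> v \<in> L2 NB"
  unfolding compressed_heat_op_def
  by (intro push_op_L2 heat_semigroup_L2[OF heat] lift_op_L2)

lemma compressed_heat_op_pairing:
  assumes "0 < \<tau>" "v \<in> L2 NB" "w \<in> L2 NB"
  shows "(\<integral>b. v b * S \<tau> w b \<partial>NB) = (\<integral>x. lift_op \<pi> A v x * T \<tau> (lift_op \<pi> A w) x \<partial>N)"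
  unfolding compressed_heat_op_def
  using assms by (simp add: push_op_pairing(2) heat_semigroup_L2[OF heat] lift_op_L2 mult.commute)

text \<open>Since \<open>S\<close> is \<open>T\<close> conjugated by the lift and its adjoint, it
  inherits the symmetry of \<open>T\<close>.\<close>

lemma compressed_heat_op_symmetric:
  assumes "0 < \<tau>" "v \<in> L2 NB" "w \<in> L2 NB"
  shows "(\<integral>b. v b * S \<tau> w b \<partial>NB) = (\<integral>b. S \<tau> v b * w b \<partial>NB)"
  using compressed_heat_op_pairing[OF assms] compressed_heat_op_pairing[OF assms(1,3,2)]
    heat_semigroup_inner(2)[OF heat assms(1,1) lift_op_L2[OF assms(3)] lift_op_L2[OF assms(2)]]
  by (simp add: mult.commute)

lemma kernel_pairing_compressed:
  assumes "heat_kernel N T K" "0 < \<tau>" "v \<in> L2 NB" "w \<in> L2 NB"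
  shows "(\<integral>(x, y). K x y \<tau> * lift_op \<pi> A v x * lift_op \<pi> A w y \<partial>(N \<Otimes>\<^sub>M N)) =
    (\<integral>b. v b * S \<tau> w b \<partial>NB)"
  using heat_kernel_pairing[OF sigma_finite_total heat assms(1,2) lift_op_L2[OF assms(3)]
      lift_op_L2[OF assms(4)]] compressed_heat_op_pairing[OF assms(2-4)]
  by simp

text \<open>By symmetry, the squared norm of \<open>S \<tau> v\<close> pairs \<open>v\<close> with
  \<open>S \<tau> (S \<tau> v)\<close>. The difference is thus the pairing of \<open>v\<close> with
  the semigroup defect, which Cauchy-Schwarz and the operator norm control.\<close>

lemma compressed_heat_op_norm_defect:
  assumes "0 < \<tau>" and v: "v \<in> L2 NB"
    and c: "L2_opnorm NB (\<lambda>v b. S \<tau> (S \<tau> v) b - S (\<tau> + \<tau>) v b) \<le> ereal c"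
  shows "\<bar>(L2_norm NB (S \<tau> v))\<^sup>2 - (\<integral>b. v b * S (\<tau> + \<tau>) v b \<partial>NB)\<bar> \<le> c * (L2_norm NB v)\<^sup>2"
proof -
  define d where "d b = S \<tau> (S \<tau> v) b - S (\<tau> + \<tau>) v b" for b
  have S: "S \<tau> v \<in> L2 NB" "S \<tau> (S \<tau> v) \<in> L2 NB" "S (\<tau> + \<tau>) v \<in> L2 NB"
    using assms by (auto intro!: compressed_heat_op_L2)
  then have d: "d \<in> L2 NB"
    unfolding d_def by (intro L2_diff)
  have "(L2_norm NB (S \<tau> v))\<^sup>2 = (\<integral>b. v b * S \<tau> (S \<tau> v) b \<partial>NB)"
    unfolding L2_norm_power2
    using compressed_heat_op_symmetric[OF \<open>0 < \<tau>\<close> v S(1)] by (simp add: power2_eq_square)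
  then have "(L2_norm NB (S \<tau> v))\<^sup>2 - (\<integral>b. v b * S (\<tau> + \<tau>) v b \<partial>NB) = (\<integral>b. v b * d b \<partial>NB)"
    using L2_integrable_mult[OF v S(2)] L2_integrable_mult[OF v S(3)]
    by (simp add: d_def right_diff_distrib)
  also have "\<bar>\<dots>\<bar> \<le> L2_norm NB v * L2_norm NB d"
    by (rule L2_Cauchy_Schwarz[OF v d])
  also have "\<dots> \<le> L2_norm NB v * (c * L2_norm NB v)"
  \<comment> \<open>The operator norm says nothing about a \<open>v\<close> of norm zero, but then
    both sides vanish.\<close>
  proof (cases "L2_norm NB v = 0")
    case False
    then have "L2_norm NB d \<le> c * L2_norm NB v"
      using L2_opnorm_bound[OF v c] unfolding d_def by simp
    then show ?thesis
      by (rule mult_left_mono) simp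
  qed simp
  finally show ?thesis
    by (simp add: power2_eq_square mult_ac)
qed

end

end

section \<open>Weak and strong convergence\<close>

lemma L2_weak_limit_of_strong:
  assumes lim: "((\<lambda>t. L2_norm M (\<lambda>x. f t x - g x)) \<longlongrightarrow> 0) F"
    and "\<forall>\<^sub>F t in F. f t \<in> L2 M" "g \<in> L2 M" and u: "u \<in> L2 M"
  shows "((\<lambda>t. \<integral>x. u x * f t x \<partial>M) \<longlongrightarrow> (\<integral>x. u x * g x \<partial>M)) F"
proof (rule LIM_zero_cancel, rule Lim_null_comparison)
  show "((\<lambda>t. L2_norm M u * L2_norm M (\<lambda>x. f t x - g x)) \<longlongrightarrow> 0) F"
    using tendsto_mult_right_zero[OF lim] .
  show "\<forall>\<^sub>F t in F. norm ((\<integral>x. u x * f t x \<partial>M) - (\<integral>x. u x * g x \<partial>M))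
      \<le> L2_norm M u * L2_norm M (\<lambda>x. f t x - g x)"
    using assms(2)
  proof eventually_elim
    case (elim t)
    have "(\<integral>x. u x * f t x \<partial>M) - (\<integral>x. u x * g x \<partial>M) = (\<integral>x. u x * (f t x - g x) \<partial>M)"
      using L2_integrable_mult[OF u elim] L2_integrable_mult[OF u assms(3)]
      by (simp add: right_diff_distrib)
    then show ?case
      using L2_Cauchy_Schwarz[OF u L2_diff[OF elim assms(3)]] by simp
  qed
qed

text \<open>Expanding the squared norm of \<open>f t - g\<close> leaves only the norm of
  \<open>f t\<close> and its pairing with \<open>g\<close>, so testing against the limit itself is
  enough.\<close>

lemma L2_strong_limit_of_weak:
  assumes weak: "((\<lambda>t. \<integral>x. g x * f t x \<partial>M) \<longlongrightarrow> (L2_norm M g)\<^sup>2) F"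
    and norms: "((\<lambda>t. (L2_norm M (f t))\<^sup>2) \<longlongrightarrow> (L2_norm M g)\<^sup>2) F"
    and "\<forall>\<^sub>F t in F. f t \<in> L2 M" "g \<in> L2 M"
  shows "((\<lambda>t. L2_norm M (\<lambda>x. f t x - g x)) \<longlongrightarrow> 0) F"
proof -
  have "((\<lambda>t. (L2_norm M (f t))\<^sup>2 - 2 * (\<integral>x. g x * f t x \<partial>M) + (L2_norm M g)\<^sup>2) \<longlongrightarrow>
      (L2_norm M g)\<^sup>2 - 2 * (L2_norm M g)\<^sup>2 + (L2_norm M g)\<^sup>2) F"
    by (intro tendsto_intros weak norms)
  moreover have "\<forall>\<^sub>F t in F. (L2_norm M (f t))\<^sup>2 - 2 * (\<integral>x. g x * f t x \<partial>M) + (L2_norm M g)\<^sup>2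
      = (L2_norm M (\<lambda>x. f t x - g x))\<^sup>2"
    using assms(3) by eventually_elim (simp add: L2_norm_diff_power2 assms(4) mult.commute)
  ultimately have "((\<lambda>t. (L2_norm M (\<lambda>x. f t x - g x))\<^sup>2) \<longlongrightarrow> 0) F"
    by (simp add: tendsto_cong)
  from tendsto_real_sqrt[OF this] show ?thesis
    by simp
qed

section \<open>Equivalence of strong convergence and convergence of the kernel pairings\<close>

theorem theorem4p9:
  fixes B :: "('b, 2) riem" and D B0 :: "'b set" and t0 :: real
    and X :: "real \<Rightarrow> ('x, 4) riem" and \<pi> :: "real \<Rightarrow> 'x \<Rightarrow> 'b" and s :: "real \<Rightarrow> real"
    and \<mu>B :: "'b measure" and \<mu> :: "real \<Rightarrow> 'x measure" and \<theta> :: "real \<Rightarrow> 'b \<Rightarrow> 'x measure"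
    and A :: "real \<Rightarrow> 'b \<Rightarrow> real" and \<rho> :: "real \<Rightarrow> 'x \<Rightarrow> real"
    and TB :: "real \<Rightarrow> ('b \<Rightarrow> real) \<Rightarrow> 'b \<Rightarrow> real"
    and T :: "real \<Rightarrow> real \<Rightarrow> ('x \<Rightarrow> real) \<Rightarrow> 'x \<Rightarrow> real"
    and KB :: "'b \<Rightarrow> 'b \<Rightarrow> real \<Rightarrow> real" and K :: "real \<Rightarrow> 'x \<Rightarrow> 'x \<Rightarrow> real \<Rightarrow> real"
    and X0 :: "real \<Rightarrow> 'x set" and NB :: "'b measure" and N :: "real \<Rightarrow> 'x measure"
    and I :: "real \<Rightarrow> ('b \<Rightarrow> real) \<Rightarrow> 'x \<Rightarrow> real"
    and S :: "real \<Rightarrow> real \<Rightarrow> ('b \<Rightarrow> real) \<Rightarrow> 'b \<Rightarrow> real"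
  defines "X0 \<equiv> \<lambda>t. {x \<in> topspace (mtop (X t)). \<pi> t x \<in> B0}"
    and "NB \<equiv> restrict_space \<mu>B B0"
    and "N \<equiv> \<lambda>t. restrict_space (\<mu> t) (X0 t)"
    and "I \<equiv> \<lambda>t. lift_op (\<pi> t) (A t)"
    and "S \<equiv> \<lambda>t. compressed_heat_op (\<pi> t) (\<theta> t) (A t) (\<rho> t) (T t)"
  assumes setting: "torus_collapse B D B0 t0 X \<pi> s \<mu>B \<mu> \<theta> A \<rho> TB T KB K"
    and almost_semigroup: "\<exists>C>0. \<forall>t\<in>{0<..t0}. \<forall>\<tau>>0. \<forall>\<sigma>>0.
      L2_opnorm NB (\<lambda>v b. S t \<tau> (S t \<sigma> v) b - S t (\<tau> + \<sigma>) v b) \<le> ereal (C * s t / sqrt \<sigma>)"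
  shows "(\<forall>\<tau>>0. \<forall>v\<in>L2 NB. ((\<lambda>t. L2_norm NB (\<lambda>b. S t \<tau> v b - TB \<tau> v b)) \<longlongrightarrow> 0) (at_right 0))
    \<longleftrightarrow>
    (\<forall>\<tau>>0. \<forall>\<Phi>\<in>L2 NB. \<forall>\<Psi>\<in>L2 NB.
      ((\<lambda>t. \<integral>(x, y). K t x y \<tau> * I t \<Phi> x * I t \<Psi> y \<partial>(N t \<Otimes>\<^sub>M N t)) \<longlongrightarrow>
        (\<integral>(b, b'). KB b b' \<tau> * \<Phi> b * \<Psi> b' \<partial>(NB \<Otimes>\<^sub>M NB))) (at_right 0))"
proof -
  interpret torus_collapse B D B0 t0 X \<pi> s \<mu>B \<mu> \<theta> A \<rho> TB T KB K X0 NB N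
    using setting by (simp_all add: X0_def NB_def N_def)
  have X0: "openin (mtop (X t)) (X0 t)"
    and proj: "\<pi> t \<in> N t \<rightarrow>\<^sub>M NB" if t: "t \<in> {0<..t0}" for t
  proof -
    have cont: "continuous_map (mtop (X t)) (mtop B) (\<pi> t)"
      using projection(1)[OF t] by (simp add: submersion_def smooth_map_def)
    then show "openin (mtop (X t)) (X0 t)"
      using B0(1) openin_continuous_map_preimage unfolding X0_def by blast
    show "\<pi> t \<in> N t \<rightarrow>\<^sub>M NB"
      using continuous_map_measurable_restrict[OF cont _ _ B0(1)] surface(2) total_space(2)[OF t]
      unfolding N_def NB_def X0_def by (simp add: riemannian_measure_def)
  qed
  have "B0 \<in> sets \<mu>B"
    using surface(2) openin_sets_borel_of[OF B0(1)] by (simp add: riemannian_measure_def)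
  then have sf_B: "sigma_finite_measure NB"
    using sigma_finite_riemannian_measure[OF surface] sigma_finite_measure_restrict_space
    unfolding NB_def by blast
  \<comment> \<open>The closure of \<open>B0\<close> avoids \<open>D\<close>, so the Haar measures
    are available on all fibres over \<open>B0\<close>.\<close>
  have B0_base: "B0 \<subseteq> topspace (mtop B) - D"
    using B0(5) closure_of_subset[OF openin_subset[OF B0(1)]] by blast
  have fib: "disintegrated_fibration NB (N t) (\<pi> t) (\<theta> t) (A t) (\<rho> t)" if t: "t \<in> {0<..t0}" for t
  proof (rule disintegrated_fibration.intro)
    have sets_\<mu>: "sets (\<mu> t) = sets (borel_of (mtop (X t)))"
      using total_space(2)[OF t] by (simp add: riemannian_measure_def)
    then have X0_sets: "X0 t \<in> sets (\<mu> t)"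
      using openin_sets_borel_of[OF X0[OF t]] by simp
    then show "sigma_finite_measure (N t)"
      using sigma_finite_riemannian_measure[OF total_space[OF t]] sigma_finite_measure_restrict_space
      unfolding N_def by blast
    show "x \<in> space (N t) \<and> \<pi> t x = b" if b: "b \<in> space NB" and x: "x \<in> space (\<theta> t b)" for b x
    proof -
      have "b \<in> B0"
        using b by (simp add: NB_def space_restrict_space)
      then have "sets (\<theta> t b) =
          sets (borel_of (subtopology (mtop (X t)) {x \<in> topspace (mtop (X t)). \<pi> t x = b}))"
        using haar[OF t, of b] B0_base unfolding torus_haar_measure_def by blast
      \<comment> \<open>The sigma-algebra determines the underlying space, so the space of
        \<open>\<theta> t b\<close> is the fibre over \<open>b\<close>.\<close>
      from sets_eq_imp_space_eq[OF this] have "x \<in> topspace (mtop (X t))" "\<pi> t x = b"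
        using x by (auto simp: space_borel_of)
      moreover have "space (N t) = X0 t"
        using sets.sets_into_space[OF X0_sets] by (auto simp: N_def space_restrict_space)
      ultimately show ?thesis
        using \<open>b \<in> B0\<close> by (simp add: X0_def)
    qed
  qed (use t sf_B proj disintegration in auto)
  have small: "\<forall>\<^sub>F t in at_right 0. t \<in> {0<..t0}"
    using t0 by (auto simp: eventually_at_right_field intro!: exI[of _ t0])
  have S_L2: "S t \<tau> v \<in> L2 NB" if "t \<in> {0<..t0}" "0 < \<tau>" "v \<in> L2 NB" for t \<tau> v
    unfolding S_def
    using disintegrated_fibration.compressed_heat_op_L2[OF fib heat] that by blast
  then have ev_S_L2: "\<forall>\<^sub>F t in at_right 0. S t \<tau> v \<in> L2 NB" if "0 < \<tau>" "v \<in> L2 NB" for \<tau> v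
    using small that by (auto elim: eventually_mono)
  note TB_L2 = heat_semigroup_L2[OF heat_B]
  \<comment> \<open>This is (K) with the kernels replaced by the operators. The pairings for
    \<open>t\<close> agree only on \<open>{0<..t0}\<close>, which suffices for the limit.\<close>
  define weak where "weak \<longleftrightarrow> (\<forall>\<tau>>0. \<forall>\<Phi>\<in>L2 NB. \<forall>\<Psi>\<in>L2 NB.
    ((\<lambda>t. \<integral>b. \<Phi> b * S t \<tau> \<Psi> b \<partial>NB) \<longlongrightarrow> (\<integral>b. \<Phi> b * TB \<tau> \<Psi> b \<partial>NB)) (at_right 0))"
  have "((\<lambda>t. \<integral>(x, y). K t x y \<tau> * I t \<Phi> x * I t \<Psi> y \<partial>(N t \<Otimes>\<^sub>M N t)) \<longlongrightarrow>
        (\<integral>(b, b'). KB b b' \<tau> * \<Phi> b * \<Psi> b' \<partial>(NB \<Otimes>\<^sub>M NB))) (at_right 0) \<longleftrightarrow>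
      ((\<lambda>t. \<integral>b. \<Phi> b * S t \<tau> \<Psi> b \<partial>NB) \<longlongrightarrow> (\<integral>b. \<Phi> b * TB \<tau> \<Psi> b \<partial>NB)) (at_right 0)"
    if "0 < \<tau>" "\<Phi> \<in> L2 NB" "\<Psi> \<in> L2 NB" for \<tau> \<Phi> \<Psi>
  proof -
    have "\<forall>\<^sub>F t in at_right 0. (\<integral>(x, y). K t x y \<tau> * I t \<Phi> x * I t \<Psi> y \<partial>(N t \<Otimes>\<^sub>M N t)) =
        (\<integral>b. \<Phi> b * S t \<tau> \<Psi> b \<partial>NB)"
      using small
    proof eventually_elim
      case (elim t)
      show ?case
        unfolding I_def S_def
        by (rule disintegrated_fibration.kernel_pairing_compressed[OF fib[OF elim] heat[OF elim] kernel[OF elim] that])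
    qed
    then show ?thesis
      unfolding heat_kernel_pairing[OF sf_B heat_B kernel_B that] by (rule tendsto_cong)
  qed
  then have weak_iff: "(\<forall>\<tau>>0. \<forall>\<Phi>\<in>L2 NB. \<forall>\<Psi>\<in>L2 NB.
      ((\<lambda>t. \<integral>(x, y). K t x y \<tau> * I t \<Phi> x * I t \<Psi> y \<partial>(N t \<Otimes>\<^sub>M N t)) \<longlongrightarrow>
        (\<integral>(b, b'). KB b b' \<tau> * \<Phi> b * \<Psi> b' \<partial>(NB \<Otimes>\<^sub>M NB))) (at_right 0)) \<longleftrightarrow> weak"
    unfolding weak_def by blast
  have strong_if_weak: "((\<lambda>t. L2_norm NB (\<lambda>b. S t \<tau> v b - TB \<tau> v b)) \<longlongrightarrow> 0) (at_right 0)"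
    if weak and \<tau>: "0 < \<tau>" and v: "v \<in> L2 NB" for \<tau> v
  proof -
    note w = \<open>weak\<close>[unfolded weak_def, rule_format]
    \<comment> \<open>The almost semigroup bound is used with \<open>\<sigma> = \<tau>\<close>. As
      \<open>\<tau>\<close> stays fixed, it tends to \<open>0\<close> with
      \<open>s t\<close>.\<close>
    obtain C where C: "\<And>t. t \<in> {0<..t0} \<Longrightarrow>
        L2_opnorm NB (\<lambda>v b. S t \<tau> (S t \<tau> v) b - S t (\<tau> + \<tau>) v b) \<le> ereal (C * s t / sqrt \<tau>)"
      using almost_semigroup \<tau> by blast
    have "((\<lambda>t. (L2_norm NB (S t \<tau> v))\<^sup>2 - (\<integral>b. v b * S t (\<tau> + \<tau>) v b \<partial>NB)) \<longlongrightarrow> 0) (at_right 0)"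
    proof (rule Lim_null_comparison)
      show "\<forall>\<^sub>F t in at_right 0. norm ((L2_norm NB (S t \<tau> v))\<^sup>2 - (\<integral>b. v b * S t (\<tau> + \<tau>) v b \<partial>NB))
          \<le> C * s t / sqrt \<tau> * (L2_norm NB v)\<^sup>2"
        using small
      proof eventually_elim
        case (elim t)
        show ?case
          unfolding real_norm_def S_def
          by (rule disintegrated_fibration.compressed_heat_op_norm_defect[OF fib[OF elim] heat[OF elim]
                \<tau> v C[OF elim, unfolded S_def]])
      qed
      have "((\<lambda>t. C * s t / sqrt \<tau> * (L2_norm NB v)\<^sup>2) \<longlongrightarrow> C * 0 / sqrt \<tau> * (L2_norm NB v)\<^sup>2) (at_right 0)"
        using \<tau> by (intro tendsto_intros scale(2)) auto
      then show "((\<lambda>t. C * s t / sqrt \<tau> * (L2_norm NB v)\<^sup>2) \<longlongrightarrow> 0) (at_right 0)"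
        by simp
    qed
    \<comment> \<open>Adding the weak limit at time \<open>\<tau> + \<tau>\<close> with both test
      functions equal to \<open>v\<close> gives the limit of the squared norms. The semigroup law
      for \<open>TB\<close> identifies it.\<close>
    from tendsto_add[OF this w[OF add_pos_pos[OF \<tau> \<tau>] v v]]
    have "((\<lambda>t. (L2_norm NB (S t \<tau> v))\<^sup>2) \<longlongrightarrow> (L2_norm NB (TB \<tau> v))\<^sup>2) (at_right 0)"
      using heat_semigroup_inner(1)[OF heat_B \<tau> \<tau> v v]
      by (simp add: L2_norm_power2[of NB "TB \<tau> v"]) (simp add: power2_eq_square)
    \<comment> \<open>Weak convergence is tested against the expected limit
      \<open>TB \<tau> v\<close>.\<close>
    moreover have "((\<lambda>t. \<integral>b. TB \<tau> v b * S t \<tau> v b \<partial>NB) \<longlongrightarrow> (L2_norm NB (TB \<tau> v))\<^sup>2) (at_right 0)"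
      unfolding L2_norm_power2 using w[OF \<tau> TB_L2[OF \<tau> v] v] by (simp add: power2_eq_square)
    ultimately show ?thesis
      using ev_S_L2[OF \<tau> v] TB_L2[OF \<tau> v] by (intro L2_strong_limit_of_weak)
  qed
  show ?thesis
    unfolding weak_iff
  proof
    assume "\<forall>\<tau>>0. \<forall>v\<in>L2 NB. ((\<lambda>t. L2_norm NB (\<lambda>b. S t \<tau> v b - TB \<tau> v b)) \<longlongrightarrow> 0) (at_right 0)"
    then show weak
      unfolding weak_def using ev_S_L2 TB_L2 by (auto intro!: L2_weak_limit_of_strong)
  qed (use strong_if_weak in blast)
qed

end
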